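(* For every $n\ge 3$, the inversion sequence $\sigma=(0,1,2,\ldots,n-3,0,1)\in I_n$ (that is, $\sigma_i=i-1$ for $1\le i\le n-2$, $\sigma_{n-1}=0$, $\sigma_n=1$) satisfies $\Theta^{n-3}(\sigma)\ne\Theta^{n-2}(\sigma)$. Consequently, the bound of $n-2$ iterations in the statement "for every $\sigma\in I_n$, the sequence $\Theta^{n-2}(\sigma)$ is fixed by $\Theta$" is sharp.
   Context: $I_n$ is the set of inversion sequences of length $n$, i.e. integer sequences $\sigma=(\sigma_1,\ldots,\sigma_n)$ with $0\le\sigma_i<i$ for every $1\le i\le n$. For a finite integer sequence $\sigma$ of length $n$, $\Theta(\sigma)$ is the sequence of length $n$ defined by $\Theta(\sigma)_i=\#\{j<i:\sigma_j<\sigma_i\}$. $\Theta^k$ denotes the $k$-fold iterate of $\Theta$, with $\Theta^0$ the identity. A sequence $\tau$ is fixed by $\Theta$ if $\Theta(\tau)=\tau$. Sharpness means that $n-2$ cannot be replaced by $n-3$: not every $\sigma\in I_n$ has $\Theta^{n-3}(\sigma)$ fixed by $\Theta$. *)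

theory Defs
  imports Main
begin

(* Sequences (s_1, ..., s_n) are lists of length n, so that s_i is s ! (i - 1). *)

definition inversion_sequences :: "nat \<Rightarrow> int list set" where
  "inversion_sequences n =
     {s. length s = n \<and> (\<forall>i\<in>{1..n}. 0 \<le> s ! (i - 1) \<and> s ! (i - 1) < int i)}"

(* Here i and j run over 0-based positions. *)
definition Theta :: "int list \<Rightarrow> int list" where
  "Theta s = map (\<lambda>i. int (card {j. j < i \<and> s ! j < s ! i})) [0..<length s]"

definition fixed_by_Theta :: "int list \<Rightarrow> bool" where
  "fixed_by_Theta t \<longleftrightarrow> Theta t = t"

(* (0, 1, ..., n - 3, 0, 1); meant for n \<ge> 3, where the subtraction does not truncate. *)
definition witness :: "nat \<Rightarrow> int list" where
  "witness n = map int [0..<n - 2] @ [0, 1]"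

end

theory Submission
  imports Defs
begin

(* On the sequences (0, 1, ..., m - 1, 0, v) with 1 \<le> v \<le> m, Theta only raises the last
   entry by one: below v lie the entries 0, ..., v - 1 of the initial run and the second 0.
   The witness starts at v = 1 with m = n - 2, so iterate n - 3 ends in n - 2 and iterate n - 2
   ends in n - 1. *)

lemma Theta_run_zero_append:
  assumes "1 \<le> v" "v \<le> m"
  shows "Theta (map int [0..<m] @ [0, int v]) = map int [0..<m] @ [0, int (Suc v)]"
proof -
  let ?s = "map int [0..<m] @ [0, int v]"
  have run: "?s ! j = int j" if "j < m" for j
    using that by (simp add: nth_append)
  have zero: "?s ! m = 0" and last: "?s ! Suc m = int v"
    by (simp_all add: nth_append)
  have "card {j. j < i \<and> ?s ! j < ?s ! i} = i" if "i < m" for i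
  proof -
    have "{j. j < i \<and> ?s ! j < ?s ! i} = {..<i}"
      using that run by auto
    then show ?thesis by simp
  qed
  moreover have "card {j. j < m \<and> ?s ! j < ?s ! m} = 0"
  proof -
    have "{j. j < m \<and> ?s ! j < ?s ! m} = {}"
      using run zero by auto
    then show ?thesis by simp
  qed
  moreover have "card {j. j < Suc m \<and> ?s ! j < ?s ! Suc m} = Suc v"
  proof -
    \<comment> \<open>Position \<open>m\<close> counts because \<open>1 \<le> v\<close>;
      \<open>v \<le> m\<close> keeps \<open>{..<v}\<close> inside the run and disjoint from
      \<open>m\<close>.\<close>
    have "{j. j < Suc m \<and> ?s ! j < ?s ! Suc m} = insert m {..<v}"
      using assms run zero last by (auto simp: less_Suc_eq)
    then show ?thesis using assms by simp
  qed
  \<comment> \<open>The index list \<open>[0..<Suc (Suc m)]\<close> splits into the run and the last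
    two positions, one count for each.\<close>
  ultimately show ?thesis
    by (simp add: Theta_def)
qed

lemma Theta_funpow_witness:
  assumes "n \<ge> 3" "k \<le> n - 2"
  shows "(Theta ^^ k) (witness n) = map int [0..<n - 2] @ [0, int (Suc k)]"
  using assms(2)
proof (induction k)
  case 0
  then show ?case by (simp add: witness_def)
next
  case (Suc k)
  \<comment> \<open>The bound \<open>Suc k \<le> n - 2\<close> is exactly the condition
    \<open>v \<le> m\<close> for the last entry \<open>v = Suc k\<close>.\<close>
  then show ?case
    using Theta_run_zero_append[of "Suc k" "n - 2"] by simp
qed

lemma witness_in_inversion_sequences:
  assumes "n \<ge> 3"
  shows "witness n \<in> inversion_sequences n"
  using assms by (auto simp: inversion_sequences_def witness_def nth_append nth_Cons split: nat.split)

theorem proposition3p7: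
  fixes n :: nat
  assumes "n \<ge> 3"
  shows "witness n \<in> inversion_sequences n \<and>
    (Theta ^^ (n - 3)) (witness n) \<noteq> (Theta ^^ (n - 2)) (witness n) \<and>
    \<not> (\<forall>\<sigma> \<in> inversion_sequences n. fixed_by_Theta ((Theta ^^ (n - 3)) \<sigma>))"
proof (intro conjI)
  show wit: "witness n \<in> inversion_sequences n"
    using assms by (rule witness_in_inversion_sequences)
  show neq: "(Theta ^^ (n - 3)) (witness n) \<noteq> (Theta ^^ (n - 2)) (witness n)"
    using assms by (simp add: Theta_funpow_witness)
  \<comment> \<open>Iterate \<open>n - 2\<close> is \<open>Theta\<close> of iterate
    \<open>n - 3\<close>, so their being distinct says that the latter is not fixed.\<close>
  have "n - 2 = Suc (n - 3)"
    using assms by simp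
  then have "Theta ((Theta ^^ (n - 3)) (witness n)) = (Theta ^^ (n - 2)) (witness n)"
    by simp
  with neq have "\<not> fixed_by_Theta ((Theta ^^ (n - 3)) (witness n))"
    by (simp add: fixed_by_Theta_def)
  with wit show "\<not> (\<forall>\<sigma> \<in> inversion_sequences n. fixed_by_Theta ((Theta ^^ (n - 3)) \<sigma>))"
    by blast
qed

end
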